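(* Let $A$ be a finite commutative ring with identity, $\sigma$ a ring automorphism of $A$, and $\mathcal{C}$ a principal $\sigma$-code of length $n$ generated by some monic $g(X)=\sum_{i=0}^{n-k}g_iX^i\in A[X;\sigma]$ with $g_0\in U(A)$. Then the following are equivalent (assuming in each case that the constant term of the generating skew-polynomial is a unit in $A$): (i) $\mathcal{C}^\perp$ is a principal $\sigma$-code. (ii) $\mathcal{C}^\perp$ is a principal $\sigma$-constacyclic code. (iii) $\mathcal{C}$ is a principal $\sigma$-constacyclic code.
   Context: $U(A)$ is the group of units of $A$. $A[X;\sigma]$ is the skew-polynomial ring of elements $\sum a_iX^i$ with multiplication determined by $Xa=\sigma(a)X$; $(p)_l$ is the left ideal generated by $p$. The polynomial $g$ has degree $n-k$. For $f$ monic of degree $n$, let $\phi_f:A^n\to A[X;\sigma]/(f)_l$, $(d_0,\dots,d_{n-1})\mapsto\sum_{i=0}^{n-1} d_iX^i+(f)_l$ (a bijection). A principal $(f,\sigma)$-code generated by $g$, where $g$ is a right divisor of $f$ in $A[X;\sigma]$, is the set $\phi_f^{-1}((g)_l/(f)_l)\subseteq A^n$. A linear code $\mathcal{C}\subseteq A^n$ is a principal $\sigma$-code of length $n$ (generated by $g$) if it is a principal $(f,\sigma)$-code generated by $g$ for some monic $f$ of degree $n$; it is a principal $\sigma$-constacyclic code of length $n$ if this holds with $f=X^n-a$ for some unit $a\in U(A)$. The parenthetical assumption means that "principal" in (i)-(iii) is understood as: generated by a skew-polynomial whose constant term is a unit of $A$, where a code being generated by a skew-polynomial $p$ means that the code equals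 $\phi_f^{-1}((p)_l/(f)_l)$ for some monic $f\in A[X;\sigma]$ of degree $n$ having $p$ as a right divisor (with $f=X^n-a$ for some $a\in U(A)$ in the $\sigma$-constacyclic case); a generator may always be taken monic, since its leading coefficient is a unit. The dual is $\mathcal{C}^\perp=\{y\in A^n: \sum_i x_iy_i=0\text{ for all }x\in\mathcal{C}\}$. *)

theory Defs
  imports
    "Jordan_Normal_Form.Matrix"
    "HOL-Computational_Algebra.Polynomial"
    "HOL-Library.Set_Algebras"
begin

section \<open>Skew polynomials\<close>

text \<open>
  The additive group of \<open>A[X;\<sigma>]\<close> is that of \<^typ>\<open>'a poly\<close>, elements being written with
  coefficients on the left; only the multiplication depends on \<open>\<sigma>\<close>. The ordinary product
  of \<^typ>\<open>'a poly\<close> is never used.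
\<close>

definition skew_mult ::
  "('a::comm_ring_1 \<Rightarrow> 'a) \<Rightarrow> 'a poly \<Rightarrow> 'a poly \<Rightarrow> 'a poly" where
  "skew_mult \<sigma> p q =
     (\<Sum>i\<le>degree p. \<Sum>j\<le>degree q. monom (coeff p i * (\<sigma> ^^ i) (coeff q j)) (i + j))"

definition right_divides ::
  "('a::comm_ring_1 \<Rightarrow> 'a) \<Rightarrow> 'a poly \<Rightarrow> 'a poly \<Rightarrow> bool" where
  "right_divides \<sigma> g f \<longleftrightarrow> (\<exists>h. f = skew_mult \<sigma> h g)"

definition left_ideal :: "('a::comm_ring_1 \<Rightarrow> 'a) \<Rightarrow> 'a poly \<Rightarrow> 'a poly set" where
  "left_ideal \<sigma> p = {skew_mult \<sigma> h p | h. True}"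

section \<open>Codes\<close>

definition linear_code :: "nat \<Rightarrow> 'a::comm_ring_1 vec set \<Rightarrow> bool" where
  "linear_code n C \<longleftrightarrow>
     C \<subseteq> carrier_vec n \<and> 0\<^sub>v n \<in> C \<and>
     (\<forall>x\<in>C. \<forall>y\<in>C. x + y \<in> C) \<and> (\<forall>a. \<forall>x\<in>C. a \<cdot>\<^sub>v x \<in> C)"

definition dual_code :: "nat \<Rightarrow> 'a::comm_ring_1 vec set \<Rightarrow> 'a vec set" where
  "dual_code n C = {y \<in> carrier_vec n. \<forall>x\<in>C. x \<bullet> y = 0}"

text \<open>Residue classes modulo \<open>(f)\<^sub>l\<close> are cosets, written with \<open>+o\<close>.\<close>

definition code_map ::
  "('a::comm_ring_1 \<Rightarrow> 'a) \<Rightarrow> 'a poly \<Rightarrow> 'a vec \<Rightarrow> 'a poly set" where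
  "code_map \<sigma> f d = (\<Sum>i<degree f. monom (d $ i) i) +o left_ideal \<sigma> f"

definition principal_f_code ::
  "('a::comm_ring_1 \<Rightarrow> 'a) \<Rightarrow> 'a poly \<Rightarrow> 'a poly \<Rightarrow> 'a vec set" where
  "principal_f_code \<sigma> f g =
     {d \<in> carrier_vec (degree f).
        code_map \<sigma> f d \<in> (\<lambda>q. q +o left_ideal \<sigma> f) ` left_ideal \<sigma> g}"

definition principal_code_gen ::
  "('a::comm_ring_1 \<Rightarrow> 'a) \<Rightarrow> nat \<Rightarrow> 'a poly \<Rightarrow> 'a vec set \<Rightarrow> bool" where
  "principal_code_gen \<sigma> n g C \<longleftrightarrow>
     linear_code n C \<and>
     (\<exists>f. lead_coeff f = 1 \<and> degree f = n \<and> right_divides \<sigma> g f \<and> C = principal_f_code \<sigma> f g)"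

definition principal_constacyclic_code_gen ::
  "('a::comm_ring_1 \<Rightarrow> 'a) \<Rightarrow> nat \<Rightarrow> 'a poly \<Rightarrow> 'a vec set \<Rightarrow> bool" where
  "principal_constacyclic_code_gen \<sigma> n g C \<longleftrightarrow>
     linear_code n C \<and>
     (\<exists>f a. a dvd 1 \<and> f = monom 1 n - [:a:] \<and> lead_coeff f = 1 \<and> degree f = n \<and>
        right_divides \<sigma> g f \<and> C = principal_f_code \<sigma> f g)"

text \<open>The generator of a principal code is required to have a unit as constant term, but not to
  be monic.\<close>

definition principal_code :: "('a::comm_ring_1 \<Rightarrow> 'a) \<Rightarrow> nat \<Rightarrow> 'a vec set \<Rightarrow> bool" where
  "principal_code \<sigma> n C \<longleftrightarrow> (\<exists>p. coeff p 0 dvd 1 \<and> principal_code_gen \<sigma> n p C)"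

definition principal_constacyclic_code ::
  "('a::comm_ring_1 \<Rightarrow> 'a) \<Rightarrow> nat \<Rightarrow> 'a vec set \<Rightarrow> bool" where
  "principal_constacyclic_code \<sigma> n C \<longleftrightarrow>
     (\<exists>p. coeff p 0 dvd 1 \<and> principal_constacyclic_code_gen \<sigma> n p C)"

section \<open>The ring laws\<close>

lemma skew_mult_bound:
  assumes "comm_ring_isom \<sigma>" "degree p \<le> m" "degree q \<le> n"
  shows "skew_mult \<sigma> p q =
     (\<Sum>i\<le>m. \<Sum>j\<le>n. monom (coeff p i * (\<sigma> ^^ i) (coeff q j)) (i + j))"
proof -
  interpret comm_ring_isom \<sigma> by fact
  have s0: "(\<sigma> ^^ i) 0 = 0" for i by (induction i) auto
  have "(\<Sum>j\<le>n. monom (coeff p i * (\<sigma> ^^ i) (coeff q j)) (i + j)) =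
        (\<Sum>j\<le>degree q. monom (coeff p i * (\<sigma> ^^ i) (coeff q j)) (i + j))" for i
    using assms(3) by (intro sum.mono_neutral_right) (auto simp: coeff_eq_0 s0 not_le)
  moreover have "(\<Sum>i\<le>m. \<Sum>j\<le>degree q. monom (coeff p i * (\<sigma> ^^ i) (coeff q j)) (i + j)) =
      skew_mult \<sigma> p q" unfolding skew_mult_def
    using assms(2) by (intro sum.mono_neutral_right) (auto simp: coeff_eq_0 not_le)
  ultimately show ?thesis by simp
qed

lemma skew_mult_add_left:
  assumes "comm_ring_isom \<sigma>"
  shows "skew_mult \<sigma> (p + q) r = skew_mult \<sigma> p r + skew_mult \<sigma> q r"
proof -
  let ?m = "max (degree p) (degree q)"
  have "degree (p + q) \<le> ?m" by (rule degree_add_le_max)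
  then show ?thesis
    by (simp add: skew_mult_bound[OF assms, where m = ?m and n = "degree r"]
        distrib_right add_monom[symmetric] sum.distrib)
qed

lemma skew_mult_add_right:
  assumes "comm_ring_isom \<sigma>"
  shows "skew_mult \<sigma> r (p + q) = skew_mult \<sigma> r p + skew_mult \<sigma> r q"
proof -
  interpret comm_ring_isom \<sigma> by fact
  have s: "(\<sigma> ^^ i) (x + y) = (\<sigma> ^^ i) x + (\<sigma> ^^ i) y" for i x y
    by (induction i) (auto simp: hom_add)
  let ?m = "max (degree p) (degree q)"
  have "degree (p + q) \<le> ?m" by (rule degree_add_le_max)
  then show ?thesis
    by (simp add: skew_mult_bound[OF assms, where m = "degree r" and n = ?m]
        s distrib_left add_monom[symmetric] sum.distrib)
qed

lemma skew_mult_0_left [simp]: "skew_mult \<sigma> 0 p = 0"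
  by (simp add: skew_mult_def)

lemma skew_mult_0_right:
  assumes "comm_ring_isom \<sigma>"
  shows "skew_mult \<sigma> p 0 = 0"
  using skew_mult_add_right[OF assms, of p 0 0] by simp

lemma skew_mult_monom:
  assumes "comm_ring_isom \<sigma>"
  shows "skew_mult \<sigma> (monom a i) (monom b j) = monom (a * (\<sigma> ^^ i) b) (i + j)"
proof -
  interpret comm_ring_isom \<sigma> by fact
  have s0: "(\<sigma> ^^ i) 0 = 0" for i by (induction i) auto
  have "skew_mult \<sigma> (monom a i) (monom b j) =
    (\<Sum>k\<le>i. \<Sum>l\<le>j. monom (coeff (monom a i) k * (\<sigma> ^^ k) (coeff (monom b j) l)) (k + l))"
    by (rule skew_mult_bound[OF assms]) (auto simp: degree_monom_le)
  also have "\<dots> = (\<Sum>k\<le>i. \<Sum>l\<le>j. if l = j then (if k = i then monom (a * (\<sigma> ^^ i) b) (i + j) else 0) else 0)"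
    by (intro sum.cong refl) (auto simp: s0)
  also have "\<dots> = monom (a * (\<sigma> ^^ i) b) (i + j)"
    by simp
  finally show ?thesis .
qed

lemma skew_mult_X_const:
  assumes "comm_ring_isom \<sigma>"
  shows "skew_mult \<sigma> (monom 1 1) [:a:] = skew_mult \<sigma> [:\<sigma> a:] (monom 1 1)"
  using skew_mult_monom[OF assms, of 1 1 a 0] skew_mult_monom[OF assms, of "\<sigma> a" 0 1 1]
  by (simp add: monom_0)

lemma poly_monom_induct [case_names monom add]:
  fixes p :: "'a::comm_ring_1 poly"
  assumes "\<And>a i. P (monom a i)" "\<And>p q. P p \<Longrightarrow> P q \<Longrightarrow> P (p + q)"
  shows "P p"
proof -
  have "P (\<Sum>i\<in>I. monom (coeff p i) i)" if "finite I" for I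
    using that by induction (use assms assms(1)[of 0 0] in auto)
  from this[of "{..degree p}"] show ?thesis by (simp add: poly_as_sum_of_monoms)
qed

lemma skew_mult_assoc:
  assumes "comm_ring_isom \<sigma>"
  shows "skew_mult \<sigma> (skew_mult \<sigma> p q) r = skew_mult \<sigma> p (skew_mult \<sigma> q r)"
proof -
  interpret comm_ring_isom \<sigma> by fact
  have s: "(\<sigma> ^^ i) (x * y) = (\<sigma> ^^ i) x * (\<sigma> ^^ i) y" for i x y
    by (induction i) (auto simp: hom_mult)
  note ** = skew_mult_add_left[OF assms] skew_mult_add_right[OF assms]
  show ?thesis
  proof (induction p rule: poly_monom_induct)
    case p: (monom a i)
    show ?case
    proof (induction q rule: poly_monom_induct)
      case q: (monom b j)
      show ?case
      proof (induction r rule: poly_monom_induct)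
        case (monom c k)
        show ?case
          by (simp add: skew_mult_monom[OF assms] s funpow_add mult.assoc add.assoc)
      qed (simp add: **)
    qed (simp add: **)
  qed (simp add: **)
qed

lemma skew_mult_1:
  assumes "comm_ring_isom \<sigma>"
  shows "skew_mult \<sigma> 1 p = p" "skew_mult \<sigma> p 1 = p"
proof -
  interpret comm_ring_isom \<sigma> by fact
  have s: "(\<sigma> ^^ i) 1 = 1" for i by (induction i) auto
  note ** = skew_mult_add_left[OF assms] skew_mult_add_right[OF assms]
  show "skew_mult \<sigma> 1 p = p"
  proof (induction p rule: poly_monom_induct)
    case (monom a i)
    show ?case using skew_mult_monom[OF assms, of 1 0 a i] by simp
  qed (simp add: **)
  show "skew_mult \<sigma> p 1 = p"
  proof (induction p rule: poly_monom_induct)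
    case (monom a i)
    show ?case using skew_mult_monom[OF assms, of a i 1 0] by (simp add: s)
  qed (simp add: **)
qed

lemma skew_mult_minus_left:
  assumes "comm_ring_isom \<sigma>"
  shows "skew_mult \<sigma> (- p) q = - skew_mult \<sigma> p q"
  using skew_mult_add_left[OF assms, of p "- p" q] by (simp add: eq_neg_iff_add_eq_0 add.commute)

lemma left_ideal_0: "0 \<in> left_ideal \<sigma> p"
  unfolding left_ideal_def using skew_mult_0_left[of \<sigma> p] by (metis (mono_tags, lifting) mem_Collect_eq)

lemma left_ideal_add:
  assumes "comm_ring_isom \<sigma>" "x \<in> left_ideal \<sigma> p" "y \<in> left_ideal \<sigma> p"
  shows "x + y \<in> left_ideal \<sigma> p"
  using assms(2,3) unfolding left_ideal_def
  by (auto simp: skew_mult_add_left[OF assms(1), symmetric])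

lemma left_ideal_mult:
  assumes "comm_ring_isom \<sigma>" "x \<in> left_ideal \<sigma> p"
  shows "skew_mult \<sigma> q x \<in> left_ideal \<sigma> p"
  using assms(2) unfolding left_ideal_def
  by (auto simp: skew_mult_assoc[OF assms(1), symmetric])

lemma left_ideal_uminus:
  assumes "comm_ring_isom \<sigma>" "x \<in> left_ideal \<sigma> p"
  shows "- x \<in> left_ideal \<sigma> p"
  using assms(2) unfolding left_ideal_def
  by (auto simp: skew_mult_minus_left[OF assms(1), symmetric])

lemma left_ideal_subset:
  assumes "comm_ring_isom \<sigma>" "right_divides \<sigma> g f"
  shows "left_ideal \<sigma> f \<subseteq> left_ideal \<sigma> g"
  using assms(2) unfolding left_ideal_def right_divides_def
  by (auto simp: skew_mult_assoc[OF assms(1), symmetric])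

lemma principal_f_code_eq:
  assumes "comm_ring_isom \<sigma>" "right_divides \<sigma> g f"
  shows "principal_f_code \<sigma> f g =
    {d \<in> carrier_vec (degree f). (\<Sum>i<degree f. monom (d $ i) i) \<in> left_ideal \<sigma> g}"
proof -
  have "code_map \<sigma> f d \<in> (\<lambda>q. q +o left_ideal \<sigma> f) ` left_ideal \<sigma> g \<longleftrightarrow>
      (\<Sum>i<degree f. monom (d $ i) i) \<in> left_ideal \<sigma> g" (is "?L \<longleftrightarrow> ?p \<in> _") for d
  proof
    assume ?L
    then obtain q where q: "q \<in> left_ideal \<sigma> g" "?p +o left_ideal \<sigma> f = q +o left_ideal \<sigma> f"
      by (auto simp: code_map_def)
    have "?p \<in> ?p +o left_ideal \<sigma> f"
      using left_ideal_0[of \<sigma> f] by (force simp: elt_set_plus_def)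
    then have "?p \<in> q +o left_ideal \<sigma> f" using q(2) by simp
    then obtain r where "r \<in> left_ideal \<sigma> f" "?p = q + r"
      by (auto simp: elt_set_plus_def)
    then show "?p \<in> left_ideal \<sigma> g"
      using q(1) left_ideal_subset[OF assms] left_ideal_add[OF assms(1)] by auto
  qed (auto simp: code_map_def)
  then show ?thesis by (auto simp: principal_f_code_def)
qed

lemma linear_code_principal_f_code:
  assumes "comm_ring_isom \<sigma>" "right_divides \<sigma> g f"
  shows "linear_code (degree f) (principal_f_code \<sigma> f g)"
proof -
  let ?P = "\<lambda>d. \<Sum>i<degree f. monom (d $ i) i"
  have z: "?P (0\<^sub>v (degree f)) = 0" by (intro sum.neutral) auto
  have a: "?P (x + y) = ?P x + ?P y" if "x \<in> carrier_vec (degree f)" "y \<in> carrier_vec (degree f)" for x y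
    using that by (simp add: add_monom[symmetric] sum.distrib)
  have m: "?P (a \<cdot>\<^sub>v x) = skew_mult \<sigma> (monom a 0) (?P x)" if "x \<in> carrier_vec (degree f)" for a x
  proof -
    have "skew_mult \<sigma> (monom a 0) (\<Sum>i\<in>I. monom (x $ i) i) = (\<Sum>i\<in>I. monom (a * x $ i) i)"
      if "finite I" for I
      using that
      by induction
        (simp_all add: skew_mult_0_right[OF assms(1)] skew_mult_add_right[OF assms(1)]
          skew_mult_monom[OF assms(1)])
    then show ?thesis using that by simp
  qed
  show ?thesis
    unfolding linear_code_def principal_f_code_eq[OF assms]
  proof (intro conjI ballI allI)
    fix x y
    assume "x \<in> {d \<in> carrier_vec (degree f). ?P d \<in> left_ideal \<sigma> g}"
      and "y \<in> {d \<in> carrier_vec (degree f). ?P d \<in> left_ideal \<sigma> g}"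
    then show "x + y \<in> {d \<in> carrier_vec (degree f). ?P d \<in> left_ideal \<sigma> g}"
      using a[of x y] left_ideal_add[OF assms(1), of "?P x" g "?P y"] by simp
  next
    fix b x
    assume "x \<in> {d \<in> carrier_vec (degree f). ?P d \<in> left_ideal \<sigma> g}"
    then show "b \<cdot>\<^sub>v x \<in> {d \<in> carrier_vec (degree f). ?P d \<in> left_ideal \<sigma> g}"
      using m[of x b] left_ideal_mult[OF assms(1), of "?P x" g "monom b 0"] by simp
  qed (use z left_ideal_0 in auto)
qed

end

theory Submission
  imports Defs
begin

text \<open>
  Words of length \<open>n\<close> are read as skew polynomials of degree below \<open>n\<close>; the code generated
  by \<open>g\<close> becomes the part of the left ideal \<open>(g)\<^sub>l\<close> of degree below \<open>n\<close>
  (\<open>ideal_code\<close>), whatever \<open>f\<close> was used to present it. Write \<open>S\<close> for this set, \<open>T\<close> for its dual.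

  Multiplication by \<open>X\<close> is a \<open>\<sigma>\<close>-isometry as long as no coefficient is pushed past position
  \<open>n - 1\<close> (\<open>dot_shift\<close>). This makes one property of \<open>T\<close> central: being closed under
  multiplication and division by \<open>X\<close> whenever neither wraps around (\<open>shift_closed\<close>). Any code whose
  generator has a unit as constant term has it, because then \<open>X q \<in> (p)\<^sub>l\<close> forces \<open>q \<in> (p)\<^sub>l\<close>.
  If \<open>S\<close> is constacyclic, \<open>T\<close> has it too: multiplication by \<open>X\<close> modulo \<open>X\<^sup>n - a\<close>
  maps \<open>S\<close> onto \<open>S\<close>, and its product with an unwrapped \<open>X y\<close> is \<open>\<sigma>\<close> of the original product
  (\<open>shift_closed_dual\<close>). So all three conditions reduce to a consequence of \<open>T\<close> being shift-closed.

  Assume that \<open>T\<close> is shift-closed and let \<open>0 < k < n\<close>, where \<open>g\<close> has degree \<open>n - k\<close>. The words \<open>g, X g, \<dots>, X\<^sup>k\<^sup>-\<^sup>1 g\<close> form a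
  triangular system whose diagonal entries \<open>\<sigma>\<^sup>i(g\<^sub>0)\<close> are units. Hence \<open>0\<close> is the only element of
  \<open>T\<close> of degree below \<open>k\<close>, and \<open>T\<close> contains a monic \<open>h\<close> of degree \<open>k\<close>. Division by \<open>h\<close> shows
  that \<open>T\<close> is generated by \<open>h\<close>. Finiteness of the ring enters once: were \<open>h\<^sub>0\<close> not a unit, it would be
  killed by some \<open>s \<noteq> 0\<close>, and \<open>s h\<close> divided by \<open>X\<close> would be a nonzero element of \<open>T\<close> of degree
  \<open>k - 1\<close> (\<open>unit_constant_term\<close>, \<open>dual_generator\<close>). The same triangular argument applied to \<open>h\<close>
  gives \<open>T\<^sup>\<bottom> = S\<close> (\<open>double_dual\<close>).

  Finally, \<open>z = X\<^sup>k g - X\<^sup>n + a\<close> has degree below \<open>n\<close>, and it is orthogonal to \<open>X h, X\<^sup>2 h, \<dots>\<close>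
  since these have no constant term and \<open>X\<^sup>k\<^sup>-\<^sup>1 g\<close> is orthogonal to \<open>h, X h, \<dots>\<close>. Its product with
  \<open>h\<close> is \<open>\<sigma>\<^sup>k(g\<^sub>0) + a h\<^sub>0\<close>, which vanishes for a suitable unit \<open>a\<close>. Then \<open>z \<in> T\<^sup>\<bottom> = S\<close>, so
  \<open>X\<^sup>n - a \<in> (g)\<^sub>l\<close> and \<open>S\<close> is constacyclic (\<open>constacyclic_of_dual_pair\<close>). As \<open>g\<close> and \<open>h\<close> play
  symmetric roles, \<open>T\<close> is constacyclic as well.
\<close>

section \<open>Arithmetic of skew polynomials\<close>

locale skew_polynomials = comm_ring_isom \<sigma> for \<sigma> :: "'a::comm_ring_1 \<Rightarrow> 'a"
begin

lemmas isom = comm_ring_isom_axioms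

abbreviation mult :: "'a poly \<Rightarrow> 'a poly \<Rightarrow> 'a poly" (infixl "\<star>" 70) where
  "p \<star> q \<equiv> skew_mult \<sigma> p q"

abbreviation X :: "nat \<Rightarrow> 'a poly" where
  "X i \<equiv> monom 1 i"

abbreviation shift :: "'a poly \<Rightarrow> 'a poly" where
  "shift p \<equiv> X (Suc 0) \<star> p"

lemma funpow_hom:
  "(\<sigma> ^^ i) 0 = 0" "(\<sigma> ^^ i) 1 = 1"
  "(\<sigma> ^^ i) (x + y) = (\<sigma> ^^ i) x + (\<sigma> ^^ i) y" "(\<sigma> ^^ i) (x * y) = (\<sigma> ^^ i) x * (\<sigma> ^^ i) y"
  by (induction i) (auto simp: hom_add hom_mult)

lemma funpow_unit: "x dvd 1 \<Longrightarrow> (\<sigma> ^^ i) x dvd 1"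
  by (metis dvd_def funpow_hom(2,4))

lemma unit_mult_eq_0:
  assumes "(u::'a) dvd 1" "u * x = 0"
  shows "x = 0"
proof -
  obtain v where "1 = u * v" using assms(1) by (rule dvdE)
  then have "x = v * (u * x)" by (simp add: mult.assoc[symmetric] mult.commute[of v])
  then show ?thesis using assms(2) by simp
qed

lemma skew_mult_sum_left: "finite I \<Longrightarrow> sum f I \<star> q = (\<Sum>i\<in>I. f i \<star> q)"
  by (induction I rule: finite_induct) (auto simp: skew_mult_add_left[OF isom])

lemma coeff_monom_mult:
  "coeff (monom a i \<star> q) m = (if m < i then 0 else a * (\<sigma> ^^ i) (coeff q (m - i)))"
proof (induction q rule: poly_monom_induct)
  case (monom b j)
  then show ?case by (auto simp: skew_mult_monom[OF isom] funpow_hom)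
next
  case (add p q)
  then show ?case by (auto simp: skew_mult_add_right[OF isom] funpow_hom distrib_left)
qed

lemma const_mult: "[:a:] \<star> q = smult a q"
  using coeff_monom_mult[of a 0 q] by (intro poly_eqI) (simp add: monom_0)

lemma monom_mult_eq: "monom a i \<star> q = smult a (X i \<star> q)"
  by (intro poly_eqI) (simp add: coeff_monom_mult)

lemma X_mult_simps: "shift (X i \<star> q) = X (Suc i) \<star> q" "1 \<star> q = q"
  using skew_mult_monom[OF isom, of 1 "Suc 0" 1 i] skew_mult_1[OF isom]
  by (simp_all add: skew_mult_assoc[OF isom, symmetric] hom_one)

lemma mult_as_sum: "q \<star> g = (\<Sum>i\<le>degree q. monom (coeff q i) i \<star> g)"
  using skew_mult_sum_left[of "{..degree q}" "\<lambda>i. monom (coeff q i) i" g]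
  by (simp add: poly_as_sum_of_monoms)

lemma coeff_mult_0: "coeff (q \<star> g) 0 = coeff q 0 * coeff g 0"
proof (induction q rule: poly_monom_induct)
  case (monom a i)
  then show ?case by (auto simp: coeff_monom_mult)
next
  case (add p q)
  then show ?case by (simp add: skew_mult_add_left[OF isom] distrib_right)
qed

text \<open>
  With a monic right factor the degrees add although the ring may have zero divisors: the leading
  coefficient of \<open>g\<close> is mapped by a power of \<open>\<sigma>\<close> to \<open>1\<close>.
\<close>

lemma coeff_mult_degree:
  assumes "lead_coeff g = 1"
  shows "coeff (q \<star> g) (degree q + degree g) = lead_coeff q"
proof -
  have "coeff (q \<star> g) (degree q + degree g) =
      (\<Sum>i\<le>degree q. coeff (monom (coeff q i) i \<star> g) (degree q + degree g))"
    by (subst mult_as_sum) (simp add: coeff_sum)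
  also have "\<dots> = (\<Sum>i\<le>degree q. if i = degree q then lead_coeff q else 0)"
    using assms by (intro sum.cong) (auto simp: coeff_monom_mult funpow_hom coeff_eq_0)
  finally show ?thesis by simp
qed

lemma shift_cancel: "shift p = shift q \<Longrightarrow> p = q"
proof (rule poly_eqI)
  fix i assume "shift p = shift q"
  then have "coeff (shift p) (Suc i) = coeff (shift q) (Suc i)" by simp
  then show "coeff p i = coeff q i" by (simp add: coeff_monom_mult)
qed

text \<open>
  Since \<open>X a = \<sigma>(a) X\<close>, moving \<open>X\<close> to the left of the coefficients needs \<open>\<sigma>\<^sup>-\<^sup>1\<close>; this is where
  surjectivity of \<open>\<sigma>\<close> is used.
\<close>

lemma shift_of_no_constant_term:
  assumes "coeff q 0 = 0"
  obtains p where "q = shift p"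
proof -
  obtain s where s: "q = pCons 0 s" using assms by (cases q) auto
  have i: "\<sigma> (inv_into UNIV \<sigma> x) = x" for x by (simp add: f_inv_into_f surj)
  then have "inv_into UNIV \<sigma> 0 = 0" by (metis hom_0_iff)
  then have "q = shift (map_poly (inv_into UNIV \<sigma>) s)"
    by (intro poly_eqI)
      (auto simp: s coeff_monom_mult coeff_map_poly i coeff_pCons split: nat.split)
  then show thesis by (rule that)
qed

text \<open>
  In \<open>X p = q g\<close> the constant term \<open>q\<^sub>0 g\<^sub>0\<close> is zero, so \<open>q\<^sub>0 = 0\<close> and \<open>X\<close> cancels.
\<close>

lemma mem_ideal_of_shift:
  assumes g: "coeff g 0 dvd 1" and p: "shift p \<in> left_ideal \<sigma> g"
  shows "p \<in> left_ideal \<sigma> g"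
proof -
  obtain q where q: "shift p = q \<star> g" using p by (auto simp: left_ideal_def)
  have "coeff (shift p) 0 = 0" by (simp add: coeff_monom_mult)
  then have "coeff g 0 * coeff q 0 = 0" by (simp add: q coeff_mult_0 mult.commute)
  then have "coeff q 0 = 0" by (rule unit_mult_eq_0[OF g])
  then obtain q' where "q = shift q'" by (rule shift_of_no_constant_term)
  with q have "p = q' \<star> g" by (metis shift_cancel skew_mult_assoc[OF isom])
  then show ?thesis by (auto simp: left_ideal_def)
qed

lemma self_mem_ideal: "g \<in> left_ideal \<sigma> g"
  unfolding left_ideal_def using skew_mult_1(1)[OF isom, of g] by (metis (mono_tags) mem_Collect_eq)

lemma X_mult_mem_ideal: "X i \<star> g \<in> left_ideal \<sigma> g"
  by (auto simp: left_ideal_def)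

section \<open>Codes as sets of polynomials\<close>

text \<open>
  A bound on the degree that also makes sense for \<open>n = 0\<close>, where \<open>degree p < n\<close> would exclude \<open>p = 0\<close>.
\<close>

definition vanishes_from :: "nat \<Rightarrow> 'a poly \<Rightarrow> bool" where
  "vanishes_from n p \<longleftrightarrow> (\<forall>i\<ge>n. coeff p i = 0)"

definition ideal_code :: "nat \<Rightarrow> 'a poly \<Rightarrow> 'a poly set" where
  "ideal_code n g = {p \<in> left_ideal \<sigma> g. vanishes_from n p}"

definition dot :: "nat \<Rightarrow> 'a poly \<Rightarrow> 'a poly \<Rightarrow> 'a" where
  "dot n p q = (\<Sum>i<n. coeff p i * coeff q i)"

definition dual :: "nat \<Rightarrow> 'a poly set \<Rightarrow> 'a poly set" where
  "dual n S = {y. vanishes_from n y \<and> (\<forall>p\<in>S. dot n p y = 0)}"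

definition submodule :: "'a poly set \<Rightarrow> bool" where
  "submodule S \<longleftrightarrow> 0 \<in> S \<and> (\<forall>p\<in>S. \<forall>q\<in>S. p + q \<in> S) \<and> (\<forall>a. \<forall>p\<in>S. smult a p \<in> S)"

lemma submoduleD:
  assumes "submodule S"
  shows "0 \<in> S" "p \<in> S \<Longrightarrow> q \<in> S \<Longrightarrow> p + q \<in> S" "p \<in> S \<Longrightarrow> smult a p \<in> S"
    "p \<in> S \<Longrightarrow> q \<in> S \<Longrightarrow> p - q \<in> S"
proof -
  show "0 \<in> S" "p \<in> S \<Longrightarrow> q \<in> S \<Longrightarrow> p + q \<in> S" "p \<in> S \<Longrightarrow> smult a p \<in> S" for p q a
    using assms by (auto simp: submodule_def)
  from this(2)[of p "smult (- 1) q"] this(3)[of q "- 1"]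
  show "p \<in> S \<Longrightarrow> q \<in> S \<Longrightarrow> p - q \<in> S" by simp
qed

lemma submodule_sum:
  assumes "submodule S" "\<And>i. i \<in> I \<Longrightarrow> f i \<in> S"
  shows "sum f I \<in> S"
  using assms(2) by (induction I rule: infinite_finite_induct) (auto intro: submoduleD[OF assms(1)])

lemma submodule_ideal_code: "submodule (ideal_code n g)"
  unfolding submodule_def ideal_code_def vanishes_from_def
  using left_ideal_0 left_ideal_add[OF isom] left_ideal_mult[OF isom, of _ g]
  by (auto simp: const_mult[symmetric]) (auto simp: const_mult)

lemma dot_add: "dot n (p + q) y = dot n p y + dot n q y" "dot n y (p + q) = dot n y p + dot n y q"
  by (simp_all add: dot_def distrib_left distrib_right sum.distrib)

lemma dot_smult: "dot n (smult a p) y = a * dot n p y" "dot n y (smult a p) = a * dot n y p"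
  by (simp_all add: dot_def sum_distrib_left mult_ac)

lemma dot_0: "dot n 0 y = 0" "dot n y 0 = 0"
  by (simp_all add: dot_def)

lemma dot_commute: "dot n p q = dot n q p"
  by (simp add: dot_def mult.commute)

lemma submodule_dual: "submodule (dual n S)"
  by (auto simp: submodule_def dual_def vanishes_from_def dot_add dot_smult dot_0)

lemma vanishes_from_mono: "vanishes_from m p \<Longrightarrow> m \<le> n \<Longrightarrow> vanishes_from n p"
  by (auto simp: vanishes_from_def)

lemma vanishes_from_0: "vanishes_from 0 p \<longleftrightarrow> p = 0"
  by (auto simp: vanishes_from_def poly_eq_iff)

lemma vanishes_from_Suc: "vanishes_from m p \<longleftrightarrow> vanishes_from (Suc m) p \<and> coeff p m = 0"
  by (auto simp: vanishes_from_def Suc_le_eq) (metis order_le_less)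

lemma vanishes_from_X_mult:
  "i + degree g < n \<Longrightarrow> vanishes_from n (X i \<star> g)"
  by (auto simp: vanishes_from_def coeff_monom_mult coeff_eq_0 funpow_hom)

lemma X_mult_mem_ideal_code: "i + degree g < n \<Longrightarrow> X i \<star> g \<in> ideal_code n g"
  by (simp add: ideal_code_def X_mult_mem_ideal vanishes_from_X_mult)

text \<open>
  As \<open>g\<close> is monic, \<open>q g\<close> has degree below \<open>n\<close> only if every \<open>X\<^sup>i\<close> occurring in \<open>q\<close> has
  \<open>i + degree g < n\<close>: the code is spanned by the \<open>X\<^sup>i g\<close> that fit into length \<open>n\<close>.
\<close>

lemma ideal_code_subset:
  assumes g: "lead_coeff g = 1" and S: "submodule S"
    and shifts: "\<And>i. i + degree g < n \<Longrightarrow> X i \<star> g \<in> S"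
  shows "ideal_code n g \<subseteq> S"
proof
  fix p assume "p \<in> ideal_code n g"
  then obtain q where q: "p = q \<star> g" and p: "vanishes_from n p"
    by (auto simp: ideal_code_def left_ideal_def)
  show "p \<in> S"
  proof (cases "q = 0")
    case True
    then show ?thesis using q submoduleD(1)[OF S] by simp
  next
    case False
    then have "degree q + degree g < n"
      using coeff_mult_degree[OF g, of q] p unfolding q vanishes_from_def
      by (metis leading_coeff_0_iff not_le)
    then show ?thesis
      unfolding q mult_as_sum[of q g]
      by (intro submodule_sum[OF S], subst monom_mult_eq, intro submoduleD(3)[OF S] shifts) auto
  qed
qed

lemma ideal_code_full_degree:
  assumes "lead_coeff g = 1" "degree g = n"
  shows "ideal_code n g = {0}"
  using ideal_code_subset[OF assms(1), of "{0}" n] assms(2) submoduleD(1)[OF submodule_ideal_code]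
  by (auto simp: submodule_def)

lemma ideal_code_1: "ideal_code n 1 = {p. vanishes_from n p}"
  using skew_mult_1(2)[OF isom] by (force simp: ideal_code_def left_ideal_def)

text \<open>
  Right division by the monic \<open>g\<close>, carried out inside \<open>S\<close>: subtracting multiples of the \<open>X\<^sup>i g\<close>
  leaves a remainder in \<open>S\<close> of degree below that of \<open>g\<close>, which is zero by assumption.
\<close>

lemma ideal_code_eqI:
  assumes g: "lead_coeff g = 1" and S: "submodule S"
    and shifts: "\<And>i. i + degree g < n \<Longrightarrow> X i \<star> g \<in> S"
    and bounded: "\<And>p. p \<in> S \<Longrightarrow> vanishes_from n p"
    and small: "\<And>p. p \<in> S \<Longrightarrow> vanishes_from (degree g) p \<Longrightarrow> p = 0"
  shows "S = ideal_code n g"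
proof
  show "ideal_code n g \<subseteq> S" by (rule ideal_code_subset[OF g S shifts])
  have reduce: "p \<in> left_ideal \<sigma> g" if "p \<in> S" "vanishes_from m p" "m \<le> n" for p m
    using that
  proof (induction m arbitrary: p)
    case 0
    then show ?case by (simp add: vanishes_from_0 left_ideal_0)
  next
    case (Suc m)
    show ?case
    proof (cases "degree g \<le> m")
      case True
      define i where "i = m - degree g"
      have i: "i + degree g = m" using True by (simp add: i_def)
      let ?r = "p - smult (coeff p m) (X i \<star> g)"
      have "X i \<star> g \<in> S" using Suc.prems i by (intro shifts) auto
      then have r: "?r \<in> S" by (intro submoduleD[OF S] Suc.prems)
      have m: "coeff (X i \<star> g) m = 1" using g i by (auto simp: coeff_monom_mult funpow_hom)
      have "vanishes_from (Suc m) (X i \<star> g)" using i by (intro vanishes_from_X_mult) auto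
      then have "vanishes_from m ?r"
        using Suc.prems(2) m by (auto simp: vanishes_from_Suc[of m]) (auto simp: vanishes_from_def)
      then have "?r \<in> left_ideal \<sigma> g" using Suc.IH r Suc.prems by auto
      moreover have "smult (coeff p m) (X i \<star> g) \<in> left_ideal \<sigma> g"
        by (metis X_mult_mem_ideal const_mult left_ideal_mult[OF isom])
      ultimately show ?thesis using left_ideal_add[OF isom] by fastforce
    next
      case False
      then have "p = 0" using small Suc.prems vanishes_from_mono[of "Suc m" p "degree g"] by auto
      then show ?thesis by (simp add: left_ideal_0)
    qed
  qed
  show "S \<subseteq> ideal_code n g"
    using reduce[of _ n] bounded by (auto simp: ideal_code_def)
qed

lemma mem_dual_ideal_code:
  assumes "lead_coeff g = 1"
  shows "y \<in> dual n (ideal_code n g) \<longleftrightarrow>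
    vanishes_from n y \<and> (\<forall>i. i + degree g < n \<longrightarrow> dot n (X i \<star> g) y = 0)"
proof -
  have "submodule {p. dot n p y = 0}" by (auto simp: submodule_def dot_add dot_smult dot_0)
  from ideal_code_subset[OF assms this, of n] show ?thesis
    using X_mult_mem_ideal_code[of _ g n] by (auto simp: dual_def)
qed

section \<open>The triangular system of the shifts of a generator\<close>

text \<open>
  \<open>X\<^sup>m g\<close> starts in position \<open>m\<close> and \<open>y\<close> ends there, so a single summand remains.
\<close>

lemma dot_triangular:
  assumes "m < n" "vanishes_from (Suc m) y"
  shows "dot n (X m \<star> g) y = (\<sigma> ^^ m) (coeff g 0) * coeff y m"
proof -
  have "dot n (X m \<star> g) y = (\<Sum>i<n. if i = m then (\<sigma> ^^ m) (coeff g 0) * coeff y m else 0)"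
    unfolding dot_def using assms(2)
    by (intro sum.cong) (auto simp: coeff_monom_mult vanishes_from_def not_less_eq_eq[symmetric])
  then show ?thesis using assms(1) by simp
qed

lemma triangular_unique:
  assumes g: "coeff g 0 dvd 1" and "m \<le> n" "vanishes_from m y" "\<And>i. i < m \<Longrightarrow> dot n (X i \<star> g) y = 0"
  shows "y = 0"
  using assms(2-)
proof (induction m)
  case 0
  then show ?case by (simp add: vanishes_from_0)
next
  case (Suc m)
  then have "(\<sigma> ^^ m) (coeff g 0) * coeff y m = 0"
    using dot_triangular[of m n y g] by simp
  then have "coeff y m = 0" by (rule unit_mult_eq_0[OF funpow_unit[OF g]])
  then show ?case using Suc by (auto simp: vanishes_from_Suc[of m])
qed

lemma triangular_solvable:
  assumes g: "coeff g 0 dvd 1" and "m \<le> n"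
  shows "\<exists>y. vanishes_from m y \<and> (\<forall>i<m. dot n (X i \<star> g) y = t i)"
  using assms(2)
proof (induction m arbitrary: t)
  case 0
  then show ?case by (intro exI[of _ 0]) (simp add: vanishes_from_0)
next
  case (Suc m)
  obtain u where u: "(\<sigma> ^^ m) (coeff g 0) * u = 1"
    using funpow_unit[OF g, of m] by (metis dvd_def)
  define z where "z = monom (u * t m) m"
  obtain y where y: "vanishes_from m y" "\<And>i. i < m \<Longrightarrow> dot n (X i \<star> g) y = t i - dot n (X i \<star> g) z"
    using Suc.IH[of "\<lambda>i. t i - dot n (X i \<star> g) z"] Suc.prems by auto
  have yz: "vanishes_from (Suc m) (y + z)" "coeff y m = 0"
    using y(1) by (auto simp: vanishes_from_def z_def)
  have "dot n (X i \<star> g) (y + z) = t i" if "i < Suc m" for i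
  proof (cases "i = m")
    case True
    have "dot n (X m \<star> g) (y + z) = (\<sigma> ^^ m) (coeff g 0) * u * t m"
      using dot_triangular[OF _ yz(1), of n g] Suc.prems yz(2) by (simp add: z_def mult.assoc)
    then show ?thesis using u True by simp
  qed (use that y(2) in \<open>auto simp: dot_add\<close>)
  with yz(1) show ?case by blast
qed

section \<open>Shifts and duality\<close>

text \<open>
  The condition on \<open>y\<close> keeps \<open>X y\<close> within length \<open>n\<close>. The constant term of \<open>X y\<close> is zero, hence
  \<open>p'\<close> may differ from \<open>X p\<close> in position \<open>0\<close>; this freedom absorbs the reduction of \<open>X p\<close> modulo
  \<open>X\<^sup>n - a\<close>, which only alters the positions \<open>0\<close> and \<open>n\<close>.
\<close>

lemma dot_shift:
  assumes "coeff y (n - 1) = 0" "n > 0" "\<And>i. 0 < i \<Longrightarrow> i < n \<Longrightarrow> coeff p' i = coeff (shift p) i"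
  shows "dot n p' (shift y) = \<sigma> (dot n p y)"
proof -
  obtain m where n: "n = Suc m" using assms(2) by (cases n) auto
  have "dot n p' (shift y) = (\<Sum>i<m. coeff p' (Suc i) * coeff (shift y) (Suc i))"
    unfolding dot_def n by (subst sum.lessThan_Suc_shift) (simp add: coeff_monom_mult)
  also have "\<dots> = (\<Sum>i<m. \<sigma> (coeff p i * coeff y i))"
    using assms(3) n by (intro sum.cong) (auto simp: coeff_monom_mult hom_mult)
  also have "\<dots> = \<sigma> (dot n p y)"
    using assms(1) by (simp add: dot_def n hom_sum)
  finally show ?thesis .
qed

definition shift_closed :: "nat \<Rightarrow> 'a poly set \<Rightarrow> bool" where
  "shift_closed n S \<longleftrightarrow>
     (\<forall>p\<in>S. coeff p (n - 1) = 0 \<longrightarrow> shift p \<in> S) \<and> (\<forall>p. shift p \<in> S \<longrightarrow> p \<in> S)"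

lemma shift_closedD:
  assumes "shift_closed n S"
  shows "p \<in> S \<Longrightarrow> coeff p (n - 1) = 0 \<Longrightarrow> shift p \<in> S" "shift p \<in> S \<Longrightarrow> p \<in> S"
  using assms unfolding shift_closed_def by blast+

lemma vanishes_from_shift:
  "vanishes_from n p \<Longrightarrow> coeff p (n - 1) = 0 \<Longrightarrow> vanishes_from n (shift p)"
  unfolding vanishes_from_def
proof (intro allI impI)
  fix i assume p: "\<forall>i\<ge>n. coeff p i = 0" "coeff p (n - 1) = 0" and i: "n \<le> i"
  have "coeff p (i - 1) = 0" using p i by (cases "i = n") auto
  then show "coeff (shift p) i = 0" by (simp add: coeff_monom_mult)
qed

lemma vanishes_from_shiftD: "vanishes_from n (shift p) \<Longrightarrow> vanishes_from n p"
  unfolding vanishes_from_def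
proof (intro allI impI)
  fix i assume "\<forall>i\<ge>n. coeff (shift p) i = 0" "n \<le> i"
  then have "coeff (shift p) (Suc i) = 0" by simp
  then show "coeff p i = 0" by (simp add: coeff_monom_mult)
qed

lemma shift_closed_ideal_code:
  assumes "coeff p 0 dvd 1"
  shows "shift_closed n (ideal_code n p)"
  unfolding shift_closed_def
proof (intro conjI ballI allI impI)
  fix q assume "q \<in> ideal_code n p" "coeff q (n - 1) = 0"
  then show "shift q \<in> ideal_code n p"
    using vanishes_from_shift left_ideal_mult[OF isom, of q p] by (simp add: ideal_code_def)
next
  fix q assume "shift q \<in> ideal_code n p"
  then show "q \<in> ideal_code n p"
    using vanishes_from_shiftD mem_ideal_of_shift[OF assms] by (simp add: ideal_code_def)
qed

lemma shift_power_mem: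
  assumes "shift_closed n S" "h \<in> S" "i + degree h < n"
  shows "X i \<star> h \<in> S"
  using assms(3)
proof (induction i)
  case 0
  then show ?case using assms(2) by (simp add: X_mult_simps)
next
  case (Suc i)
  have "coeff (X i \<star> h) (n - 1) = 0"
    using vanishes_from_X_mult[of i h "n - 1"] Suc.prems by (simp add: vanishes_from_def)
  with Suc have "shift (X i \<star> h) \<in> S" by (intro shift_closedD(1)[OF assms(1)]) auto
  then show ?case by (simp add: X_mult_simps)
qed

text \<open>
  A finite ring has only units and zero divisors. If \<open>s h\<^sub>0 = 0\<close> with \<open>s \<noteq> 0\<close>, then \<open>s h\<close> is
  divisible by \<open>X\<close>, and the quotient lies in \<open>S\<close> although its degree is too small.
\<close>

lemma unit_constant_term:
  assumes fin: "finite (UNIV :: 'a set)" and S: "submodule S" "shift_closed n S"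
    and h: "h \<in> S" "lead_coeff h = 1"
    and small: "\<And>p. p \<in> S \<Longrightarrow> vanishes_from (degree h) p \<Longrightarrow> p = 0"
  shows "coeff h 0 dvd 1"
proof (rule ccontr)
  assume "\<not> coeff h 0 dvd 1"
  then have "1 \<notin> range (\<lambda>x. coeff h 0 * x)" by (auto simp: dvd_def)
  then have "\<not> surj (\<lambda>x. coeff h 0 * x)" by auto
  then have "\<not> inj (\<lambda>x. coeff h 0 * x)" using fin finite_UNIV_inj_surj by blast
  then obtain x y where xy: "coeff h 0 * x = coeff h 0 * y" "x \<noteq> y" by (auto simp: inj_def)
  define s where "s = x - y"
  have s: "s \<noteq> 0" "s * coeff h 0 = 0" using xy by (simp_all add: s_def algebra_simps)
  then obtain p where p: "smult s h = shift p" using shift_of_no_constant_term[of "smult s h"] by auto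
  have "smult s h \<in> S" using submoduleD(3)[OF S(1)] h by simp
  then have "p \<in> S" unfolding p by (rule shift_closedD(2)[OF S(2)])
  moreover have "vanishes_from (degree h) p"
    unfolding vanishes_from_def
  proof (intro allI impI)
    fix i assume "degree h \<le> i"
    then have "coeff (shift p) (Suc i) = 0" by (simp add: p[symmetric] coeff_eq_0)
    then show "coeff p i = 0" by (simp add: coeff_monom_mult)
  qed
  ultimately have "p = 0" by (rule small)
  then have "coeff (smult s h) (degree h) = 0" by (simp add: p skew_mult_0_right[OF isom])
  then show False using s(1) h(2) by simp
qed

text \<open>
  The words \<open>g, X g, \<dots>, X\<^sup>k\<^sup>-\<^sup>1 g\<close> of the code, cut to their first \<open>k\<close> letters, form an invertible
  triangular matrix.
\<close>

lemma dual_eq_0_of_low_degree: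
  assumes "coeff g 0 dvd 1" "degree g + k = n"
    and "p \<in> dual n (ideal_code n g)" "vanishes_from k p"
  shows "p = 0"
  using assms(3) X_mult_mem_ideal_code[of _ g n] assms(2)
  by (intro triangular_unique[OF assms(1), of k n p] assms(4)) (auto simp: dual_def)

lemma double_dual:
  assumes g: "lead_coeff g = 1" and h: "lead_coeff h = 1" "coeff h 0 dvd 1"
    and n: "degree g + degree h = n"
    and gh: "dual n (ideal_code n g) = ideal_code n h"
  shows "dual n (ideal_code n h) = ideal_code n g"
proof (rule ideal_code_eqI[OF g submodule_dual])
  fix i assume "i + degree g < n"
  then have "X i \<star> g \<in> ideal_code n g" by (rule X_mult_mem_ideal_code)
  then show "X i \<star> g \<in> dual n (ideal_code n h)"
    unfolding gh[symmetric]
    by (auto simp: dual_def ideal_code_def) (metis dot_commute)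
qed (use dual_eq_0_of_low_degree[OF h(2)] n in \<open>auto simp: dual_def add.commute\<close>)

text \<open>
  The triangular system determines the monic \<open>h\<close> by its orthogonality to the \<open>X\<^sup>i g\<close>; that its
  shifts stay in the dual is what the hypothesis of shift-closedness provides.
\<close>

lemma dual_generator:
  assumes fin: "finite (UNIV :: 'a set)"
    and g: "lead_coeff g = 1" "coeff g 0 dvd 1" and n: "degree g + k = n" "0 < degree g"
    and T: "shift_closed n (dual n (ideal_code n g))"
  obtains h where "lead_coeff h = 1" "degree h = k" "coeff h 0 dvd 1"
    "dual n (ideal_code n g) = ideal_code n h"
proof -
  let ?T = "dual n (ideal_code n g)"
  obtain y where y: "vanishes_from k y" "\<And>i. i < k \<Longrightarrow> dot n (X i \<star> g) y = - dot n (X i \<star> g) (X k)"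
    using triangular_solvable[OF g(2), of k n "\<lambda>i. - dot n (X i \<star> g) (X k)"] n by auto
  \<comment> \<open>\<open>y\<close> cancels the products of \<open>X\<^sup>k\<close> with the \<open>X\<^sup>i g\<close>\<close>
  define h where "h = y + X k"
  have hk: "coeff h k = 1" "vanishes_from (Suc k) h"
    using y(1) by (auto simp: h_def vanishes_from_def)
  then have deg: "degree h = k"
    by (intro antisym degree_le le_degree) (auto simp: vanishes_from_def)
  have h: "lead_coeff h = 1" using hk deg by simp
  have hT: "h \<in> ?T"
    unfolding mem_dual_ideal_code[OF g(1)]
    using y(2) n vanishes_from_mono[OF hk(2), of n] by (auto simp: h_def dot_add)
  have small: "p = 0" if "p \<in> ?T" "vanishes_from (degree h) p" for p
    using dual_eq_0_of_low_degree[OF g(2) n(1)] that deg by simp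
  have "coeff h 0 dvd 1"
    by (rule unit_constant_term[OF fin submodule_dual T hT h small])
  moreover have "?T = ideal_code n h"
    by (rule ideal_code_eqI[OF h submodule_dual shift_power_mem[OF T hT] _ small])
      (auto simp: dual_def)
  ultimately show thesis using that h deg by blast
qed

section \<open>Constacyclic codes\<close>

text \<open>
  This is \<open>X\<^sup>k g\<close> reduced modulo \<open>X\<^sup>n - a\<close>; for \<open>k > 0\<close> it is the constacyclic shift of \<open>X\<^sup>k\<^sup>-\<^sup>1 g\<close>, the
  last word of the basis.
\<close>

lemma vanishes_from_reduced:
  assumes "lead_coeff g = 1" "k + degree g = n" "n > 0"
  shows "vanishes_from n (X k \<star> g - (X n - [:a:]))"
  unfolding vanishes_from_def
proof (intro allI impI)
  fix i assume i: "n \<le> i"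
  have "coeff [:a:] i = 0" using assms(3) i by (intro coeff_eq_0) simp
  moreover have "coeff (X k \<star> g) i = coeff (X n) i"
    using assms i by (cases "i = n") (auto simp: coeff_monom_mult funpow_hom coeff_eq_0)
  ultimately show "coeff (X k \<star> g - (X n - [:a:])) i = 0" by simp
qed

lemma mem_ideal_reduced:
  assumes "X k \<star> g - f \<in> left_ideal \<sigma> g"
  shows "f \<in> left_ideal \<sigma> g"
  using left_ideal_add[OF isom X_mult_mem_ideal[of k g] left_ideal_uminus[OF isom assms]] by simp

text \<open>
  The monic generator \<open>g\<close> of a code inherits the modulus of any other generator \<open>p\<close>: the code is
  stable under reduction modulo \<open>X\<^sup>n - a \<in> (p)\<^sub>l\<close>, so \<open>X\<^sup>k g\<close> reduced lies in the code, hence in \<open>(g)\<^sub>l\<close>.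
\<close>

lemma constacyclic_generator_change:
  assumes g: "lead_coeff g = 1" "degree g < n" and eq: "ideal_code n g = ideal_code n p"
    and f: "X n - [:a:] \<in> left_ideal \<sigma> p"
  shows "X n - [:a:] \<in> left_ideal \<sigma> g"
proof -
  obtain k where k: "Suc k + degree g = n" using g(2) by (metis add.commute less_imp_Suc_add add_Suc)
  let ?z = "X (Suc k) \<star> g - (X n - [:a:])"
  have "X k \<star> g \<in> left_ideal \<sigma> p"
    using X_mult_mem_ideal_code[of k g n] k unfolding eq by (simp add: ideal_code_def)
  then have "shift (X k \<star> g) \<in> left_ideal \<sigma> p" by (rule left_ideal_mult[OF isom])
  then have "?z \<in> left_ideal \<sigma> p"
    using left_ideal_add[OF isom _ left_ideal_uminus[OF isom f]] by (simp only: X_mult_simps diff_conv_add_uminus)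
  then have "?z \<in> ideal_code n p"
    using vanishes_from_reduced[OF g(1) k] k by (simp add: ideal_code_def)
  then have "?z \<in> left_ideal \<sigma> g" unfolding eq[symmetric] by (simp add: ideal_code_def)
  then show ?thesis by (rule mem_ideal_reduced)
qed

text \<open>
  Let \<open>T\<^sub>a\<close> be multiplication by \<open>X\<close> followed by reduction modulo \<open>X\<^sup>n - a\<close>; it maps the code onto
  itself. For closure under multiplication by \<open>X\<close>, a code word is written as \<open>c = T\<^sub>a c'\<close> and
  \<open>\<langle>T\<^sub>a c', X y\<rangle> = \<sigma>\<langle>c', y\<rangle> = 0\<close>; for closure under division, \<open>\<sigma>\<langle>c, y\<rangle> = \<langle>T\<^sub>a c, X y\<rangle> = 0\<close>.
\<close>

lemma shift_closed_dual:
  assumes g: "coeff g 0 dvd 1" and a: "a dvd 1" and n: "n > 0"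
    and f: "X n - [:a:] \<in> left_ideal \<sigma> g"
  shows "shift_closed n (dual n (ideal_code n g))"
proof -
  let ?f = "X n - [:a:]"
  have f_in: "smult b ?f \<in> left_ideal \<sigma> g" for b
    using left_ideal_mult[OF isom f, of "[:b:]"] by (simp only: const_mult)
  have f0: "coeff ?f 0 = - a" using n by simp
  have f_inner: "coeff ?f i = 0" if "0 < i" "i \<noteq> n" for i
    using that by (simp add: coeff_eq_0)
  have fn: "coeff ?f n = 1" using n by (simp add: coeff_eq_0)
  show ?thesis
    unfolding shift_closed_def
  proof (intro conjI ballI allI impI)
    fix y assume y: "y \<in> dual n (ideal_code n g)" "coeff y (n - 1) = 0"
    have "dot n c (shift y) = 0" if c: "c \<in> ideal_code n g" for c
    proof -
      obtain b where b: "1 = a * b" using a by (rule dvdE)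
      \<comment> \<open>adding this multiple of \<open>X\<^sup>n - a\<close> moves the constant term of \<open>c\<close> to position \<open>n\<close>, so that \<open>X\<close> can be divided out\<close>
      let ?q = "c + smult (b * coeff c 0) ?f"
      have "coeff ?q 0 = coeff c 0 - (a * b) * coeff c 0"
        unfolding coeff_add coeff_smult f0 by (simp add: mult_ac)
      then have "coeff ?q 0 = 0" by (simp add: b[symmetric])
      then obtain c' where c': "?q = shift c'" by (rule shift_of_no_constant_term)
      have "?q \<in> left_ideal \<sigma> g"
        using c f_in by (intro left_ideal_add[OF isom]) (auto simp: ideal_code_def)
      then have "c' \<in> left_ideal \<sigma> g" unfolding c' by (rule mem_ideal_of_shift[OF g])
      moreover have "vanishes_from n c'"
        unfolding vanishes_from_def
      proof (intro allI impI)
        fix i assume "n \<le> i"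
        then have "coeff ?q (Suc i) = 0"
          using c unfolding coeff_add coeff_smult
          by (subst f_inner) (auto simp: ideal_code_def vanishes_from_def)
        then show "coeff c' i = 0" unfolding c' by (simp add: coeff_monom_mult)
      qed
      ultimately have "dot n c' y = 0" using y(1) by (auto simp: dual_def ideal_code_def)
      moreover have "dot n c (shift y) = \<sigma> (dot n c' y)"
      proof (rule dot_shift[OF y(2) n])
        fix i assume "0 < i" "i < n"
        then show "coeff c i = coeff (shift c') i"
          unfolding c'[symmetric] coeff_add coeff_smult by (subst f_inner) auto
      qed
      ultimately show ?thesis by simp
    qed
    then show "shift y \<in> dual n (ideal_code n g)"
      using y vanishes_from_shift by (auto simp: dual_def)
  next
    fix y assume y: "shift y \<in> dual n (ideal_code n g)"
    then have "coeff (shift y) (Suc (n - 1)) = 0" using n by (auto simp: dual_def vanishes_from_def)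
    then have top: "coeff y (n - 1) = 0" by (simp add: coeff_monom_mult)
    have "dot n c y = 0" if c: "c \<in> ideal_code n g" for c
    proof -
      \<comment> \<open>the constacyclic shift of \<open>c\<close>\<close>
      define p' where "p' = shift c + smult (- \<sigma> (coeff c (n - 1))) ?f"
      have p': "coeff p' i = coeff (shift c) i - \<sigma> (coeff c (n - 1)) * coeff ?f i" for i
        by (simp only: p'_def coeff_add coeff_smult) simp
      have "c \<in> left_ideal \<sigma> g" using c by (simp add: ideal_code_def)
      then have "p' \<in> left_ideal \<sigma> g"
        unfolding p'_def by (intro left_ideal_add[OF isom] left_ideal_mult[OF isom] f_in)
      moreover have "vanishes_from n p'"
        unfolding vanishes_from_def
      proof (intro allI impI)
        fix i assume i: "n \<le> i"
        show "coeff p' i = 0"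
        proof (cases "i = n")
          case True
          then show ?thesis using n by (simp only: p' fn) (simp add: coeff_monom_mult)
        next
          case False
          then have "coeff (shift c) i = 0"
            using c i by (auto simp: coeff_monom_mult ideal_code_def vanishes_from_def)
          then show ?thesis using f_inner[of i] i n False by (simp only: p') simp
        qed
      qed
      ultimately have "dot n p' (shift y) = 0" using y by (auto simp: dual_def ideal_code_def)
      moreover have "dot n p' (shift y) = \<sigma> (dot n c y)"
      proof (rule dot_shift[OF top n])
        fix i assume "0 < i" "i < n"
        then show "coeff p' i = coeff (shift c) i" using f_inner[of i] by (simp only: p') simp
      qed
      ultimately show ?thesis by simp
    qed
    then show "y \<in> dual n (ideal_code n g)"
      using y vanishes_from_shiftD by (auto simp: dual_def)
  qed
qed

text \<open>
  By duality it suffices that the constacyclic shift \<open>z\<close> of \<open>X\<^sup>k\<^sup>-\<^sup>1 g\<close> is orthogonal to all \<open>X\<^sup>i h\<close>.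
  For \<open>i > 0\<close> this holds for every \<open>a\<close>, and the case \<open>i = 0\<close> is a linear equation for \<open>a\<close> whose
  solution is a unit because \<open>g\<^sub>0\<close> and \<open>h\<^sub>0\<close> are.
\<close>

lemma constacyclic_of_dual_pair:
  assumes g: "lead_coeff g = 1" "coeff g 0 dvd 1" and h: "lead_coeff h = 1" "coeff h 0 dvd 1"
    and n: "degree g + degree h = n" "0 < degree g" "0 < degree h"
    and gh: "dual n (ideal_code n g) = ideal_code n h"
  shows "\<exists>a. a dvd 1 \<and> X n - [:a:] \<in> left_ideal \<sigma> g"
proof -
  obtain k where k: "degree h = Suc k" using n(3) by (cases "degree h") auto
  let ?u = "(\<sigma> ^^ Suc k) (coeff g 0)"
  obtain v where v: "1 = coeff h 0 * v" using h(2) by (rule dvdE)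
  obtain w where w: "1 = ?u * w" using funpow_unit[OF g(2)] by (rule dvdE)
  \<comment> \<open>the solution of \<open>\<sigma>\<^sup>k(g\<^sub>0) + a h\<^sub>0 = 0\<close>, where \<open>k\<close> is the degree of \<open>h\<close>\<close>
  define a where "a = - ?u * v"
  have "a * (- coeff h 0 * w) = (?u * w) * (coeff h 0 * v)" by (simp add: a_def mult_ac)
  then have a: "a dvd 1" using v w by (metis dvd_def mult_1)
  define z where "z = X (Suc k) \<star> g - (X n - [:a:])"
  have vz: "vanishes_from n z"
    unfolding z_def using n k by (intro vanishes_from_reduced[OF g(1)]) auto
  have z: "z = X (Suc k) \<star> g + [:a:] + smult (- 1) (X n)" by (simp add: z_def)
  have "z \<in> dual n (ideal_code n h)"
    unfolding mem_dual_ideal_code[OF h(1)]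
  proof (intro conjI allI impI vz)
    fix i assume i: "i + degree h < n"
    show "dot n (X i \<star> h) z = 0"
    proof (cases i)
      case 0
      have "dot n (X (Suc k) \<star> g) h = ?u * coeff h (Suc k)"
        using n k by (intro dot_triangular) (auto simp: vanishes_from_def coeff_eq_0)
      then have 1: "dot n (X (Suc k) \<star> g) h = ?u" using h(1) k by simp
      obtain m where m: "n = Suc m" using n by (cases n) auto
      have 2: "dot n [:a:] h = a * coeff h 0"
        unfolding dot_def m by (subst sum.lessThan_Suc_shift) simp
      have 3: "dot n (X n) h = 0" unfolding dot_def by (intro sum.neutral) auto
      have "a * coeff h 0 = - ?u * (coeff h 0 * v)" by (simp add: a_def mult_ac)
      then have "a * coeff h 0 = - ?u" by (simp only: v[symmetric] mult_1_right)
      then have "dot n z h = 0" unfolding z dot_add dot_smult 1 2 3 by simp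
      then show ?thesis by (simp add: 0 X_mult_simps dot_commute)
    next
      case (Suc j)
      have "coeff (X j \<star> h) (n - 1) = 0"
        using vanishes_from_X_mult[of j h "n - 1"] i Suc by (simp add: vanishes_from_def)
      then have "dot n z (shift (X j \<star> h)) = \<sigma> (dot n (X k \<star> g) (X j \<star> h))"
      proof (rule dot_shift)
        fix i assume "0 < i" "i < n"
        then show "coeff z i = coeff (shift (X k \<star> g)) i"
          by (simp add: z X_mult_simps coeff_eq_0)
      qed (use n in auto)
      moreover have "X j \<star> h \<in> dual n (ideal_code n g)"
        unfolding gh using i Suc by (intro X_mult_mem_ideal_code) auto
      moreover have "X k \<star> g \<in> ideal_code n g"
        using n k by (intro X_mult_mem_ideal_code) auto
      ultimately show ?thesis
        by (simp add: Suc X_mult_simps dual_def dot_commute[of n _ z])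
    qed
  qed
  then have "z \<in> left_ideal \<sigma> g"
    unfolding double_dual[OF g(1) h n(1) gh] by (simp add: ideal_code_def)
  then have "X n - [:a:] \<in> left_ideal \<sigma> g" unfolding z_def by (rule mem_ideal_reduced)
  with a show ?thesis by blast
qed

section \<open>The equivalence for polynomials\<close>

definition principal_polys :: "nat \<Rightarrow> 'a poly set \<Rightarrow> bool" where
  "principal_polys n S \<longleftrightarrow>
     (\<exists>p f. coeff p 0 dvd 1 \<and> lead_coeff f = 1 \<and> degree f = n \<and> f \<in> left_ideal \<sigma> p \<and>
        S = ideal_code n p)"

definition constacyclic_polys :: "nat \<Rightarrow> 'a poly set \<Rightarrow> bool" where
  "constacyclic_polys n S \<longleftrightarrow>
     (\<exists>p a. coeff p 0 dvd 1 \<and> a dvd 1 \<and> X n - [:a:] \<in> left_ideal \<sigma> p \<and> S = ideal_code n p)"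

lemma binomial_monic:
  assumes "n > 0"
  shows "degree (X n - [:a:]) = n" "lead_coeff (X n - [:a:]) = 1"
proof -
  show deg: "degree (X n - [:a:]) = n"
    unfolding diff_conv_add_uminus using assms
    by (subst degree_add_eq_left) (simp_all add: degree_monom_eq)
  show "lead_coeff (X n - [:a:]) = 1"
    unfolding deg using assms by (simp add: coeff_eq_0)
qed

lemma constacyclic_imp_principal: "n > 0 \<Longrightarrow> constacyclic_polys n S \<Longrightarrow> principal_polys n S"
  unfolding constacyclic_polys_def principal_polys_def using binomial_monic by blast

lemma constacyclic_zero: "n > 0 \<Longrightarrow> constacyclic_polys n {0}"
  unfolding constacyclic_polys_def
  using self_mem_ideal[of "X n - [:1:]"] ideal_code_full_degree[of "X n - [:1:]" n] binomial_monic[of n 1]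
  by (intro exI[of _ "X n - [:1:]"] exI[of _ 1]) simp

lemma constacyclic_full: "constacyclic_polys n {p. vanishes_from n p}"
proof -
  have "p \<in> left_ideal \<sigma> 1" for p
    using skew_mult_1(2)[OF isom, of p] unfolding left_ideal_def by (metis (mono_tags) mem_Collect_eq)
  then show ?thesis
    unfolding constacyclic_polys_def ideal_code_1[symmetric]
    by (intro exI[of _ 1] exI[of _ "1::'a"]) simp
qed

text \<open>
  For the zero code and the full code all conditions hold, each being the dual of the other. Otherwise
  each condition makes the dual shift-closed, and this gives back all of them.
\<close>

lemma equivalence_polys:
  assumes fin: "finite (UNIV :: 'a set)"
    and g: "lead_coeff g = 1" "coeff g 0 dvd 1" and n: "n > 0" "degree g \<le> n"
  shows "(principal_polys n (dual n (ideal_code n g)) \<longleftrightarrow>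
            constacyclic_polys n (dual n (ideal_code n g))) \<and>
         (constacyclic_polys n (dual n (ideal_code n g)) \<longleftrightarrow>
            constacyclic_polys n (ideal_code n g))"
proof -
  let ?S = "ideal_code n g" and ?T = "dual n (ideal_code n g)"
  consider "degree g = n" | "degree g = 0" | "0 < degree g" "degree g < n" using n by linarith
  then show ?thesis
  proof cases
    case 1
    then have S: "?S = {0}" by (rule ideal_code_full_degree[OF g(1)])
    have "?T = {p. vanishes_from n p}" unfolding S by (auto simp: dual_def dot_0)
    then show ?thesis
      using S constacyclic_zero[OF n(1)] constacyclic_full constacyclic_imp_principal[OF n(1)] by metis
  next
    case 2
    then have "g = 1" using g(1) by (metis degree_0_id lead_coeff_pCons(2) one_pCons)
    then have S: "?S = {p. vanishes_from n p}" by (simp add: ideal_code_1)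
    have "?T = {0}"
      using dual_eq_0_of_low_degree[OF g(2), of n n] 2 submoduleD(1)[OF submodule_dual] by (auto simp: dual_def)
    then show ?thesis
      using S constacyclic_zero[OF n(1)] constacyclic_full constacyclic_imp_principal[OF n(1)] by metis
  next
    case 3
    have both: "constacyclic_polys n ?T \<and> constacyclic_polys n ?S" if T: "shift_closed n ?T"
    proof -
      obtain h where h: "lead_coeff h = 1" "degree h = n - degree g" "coeff h 0 dvd 1"
        and gh: "?T = ideal_code n h"
        using dual_generator[OF fin g _ 3(1) T, of "n - degree g"] n by auto
      have deg: "degree g + degree h = n" "0 < degree h" using h(2) 3 by auto
      have hg: "dual n (ideal_code n h) = ?S" by (rule double_dual[OF g(1) h(1,3) deg(1) gh])
      obtain a where "a dvd 1" "X n - [:a:] \<in> left_ideal \<sigma> g"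
        using constacyclic_of_dual_pair[OF g h(1,3) deg(1) 3(1) deg(2) gh] by blast
      moreover obtain b where "b dvd 1" "X n - [:b:] \<in> left_ideal \<sigma> h"
        using constacyclic_of_dual_pair[OF h(1,3) g _ deg(2) 3(1) hg] deg(1) by (auto simp: add.commute)
      ultimately show ?thesis unfolding gh constacyclic_polys_def using g(2) h(3) by blast
    qed
    have "shift_closed n ?T" if T: "principal_polys n ?T"
    proof -
      obtain p where p: "coeff p 0 dvd 1" "?T = ideal_code n p"
        using T unfolding principal_polys_def by blast
      show ?thesis unfolding p(2) by (rule shift_closed_ideal_code[OF p(1)])
    qed
    moreover have "shift_closed n ?T" if S: "constacyclic_polys n ?S"
    proof -
      obtain p a where a: "a dvd 1" and f: "X n - [:a:] \<in> left_ideal \<sigma> p" "?S = ideal_code n p"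
        using S unfolding constacyclic_polys_def by blast
      show ?thesis
        by (rule shift_closed_dual[OF g(2) a n(1) constacyclic_generator_change[OF g(1) 3(2) f(2,1)]])
    qed
    ultimately show ?thesis using both constacyclic_imp_principal[OF n(1)] by blast
  qed
qed

section \<open>Words and polynomials\<close>

definition code_polys :: "nat \<Rightarrow> 'a vec set \<Rightarrow> 'a poly set" where
  "code_polys n C = {p. vanishes_from n p \<and> vec n (coeff p) \<in> C}"

definition word_poly :: "nat \<Rightarrow> 'a vec \<Rightarrow> 'a poly" where
  "word_poly n v = (\<Sum>i<n. monom (v $ i) i)"

lemma coeff_word_poly: "coeff (word_poly n v) j = (if j < n then v $ j else 0)"
  by (simp add: word_poly_def coeff_sum)

lemma vec_word_poly: "v \<in> carrier_vec n \<Longrightarrow> vec n (coeff (word_poly n v)) = v"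
  by (intro eq_vecI) (auto simp: coeff_word_poly)

lemma word_poly_vec: "vanishes_from n p \<Longrightarrow> word_poly n (vec n (coeff p)) = p"
  by (intro poly_eqI) (auto simp: coeff_word_poly vanishes_from_def)

lemma word_poly_mem: "v \<in> carrier_vec n \<Longrightarrow> word_poly n v \<in> code_polys n C \<longleftrightarrow> v \<in> C"
  by (simp add: code_polys_def vec_word_poly) (simp add: vanishes_from_def coeff_word_poly)

lemma code_polys_inject:
  assumes "C \<subseteq> carrier_vec n" "D \<subseteq> carrier_vec n"
  shows "code_polys n C = code_polys n D \<longleftrightarrow> C = D"
  using word_poly_mem assms by blast

lemma code_polys_principal_f_code:
  assumes "right_divides \<sigma> p f" "degree f = n"
  shows "code_polys n (principal_f_code \<sigma> f p) = ideal_code n p"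
  using assms(2) word_poly_vec
  by (auto simp: code_polys_def principal_f_code_eq[OF isom assms(1)] ideal_code_def word_poly_def)

lemma code_polys_dual_code:
  assumes "C \<subseteq> carrier_vec n"
  shows "code_polys n (dual_code n C) = dual n (code_polys n C)"
proof -
  have dot: "v \<bullet> vec n (coeff y) = dot n (word_poly n v) y" for v y
    by (simp add: scalar_prod_def dot_def coeff_word_poly lessThan_atLeast0)
  have "(\<forall>v\<in>C. v \<bullet> vec n (coeff y) = 0) \<longleftrightarrow> (\<forall>p\<in>code_polys n C. dot n p y = 0)" for y
  proof
    assume *: "\<forall>v\<in>C. v \<bullet> vec n (coeff y) = 0"
    show "\<forall>p\<in>code_polys n C. dot n p y = 0"
    proof
      fix p assume "p \<in> code_polys n C"
      then show "dot n p y = 0"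
        using * dot[of "vec n (coeff p)" y] by (simp add: code_polys_def word_poly_vec)
    qed
  next
    assume "\<forall>p\<in>code_polys n C. dot n p y = 0"
    then show "\<forall>v\<in>C. v \<bullet> vec n (coeff y) = 0"
      unfolding dot using word_poly_mem assms by blast
  qed
  then show ?thesis by (subst code_polys_def) (simp add: dual_code_def dual_def)
qed

lemma code_eq_iff:
  assumes "C \<subseteq> carrier_vec n" "right_divides \<sigma> p f" "degree f = n"
  shows "linear_code n C \<and> C = principal_f_code \<sigma> f p \<longleftrightarrow> code_polys n C = ideal_code n p"
proof -
  have "linear_code n (principal_f_code \<sigma> f p)"
    using linear_code_principal_f_code[OF isom assms(2)] assms(3) by simp
  moreover from this have "C = principal_f_code \<sigma> f p \<longleftrightarrow> code_polys n C = ideal_code n p"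
    using code_polys_inject[OF assms(1)] code_polys_principal_f_code[OF assms(2,3)]
    by (metis linear_code_def)
  ultimately show ?thesis by metis
qed

lemma right_divides_iff: "right_divides \<sigma> p f \<longleftrightarrow> f \<in> left_ideal \<sigma> p"
  by (auto simp: right_divides_def left_ideal_def)

lemma principal_code_iff:
  assumes "C \<subseteq> carrier_vec n"
  shows "principal_code \<sigma> n C \<longleftrightarrow> principal_polys n (code_polys n C)"
  unfolding principal_code_def principal_code_gen_def principal_polys_def right_divides_iff[symmetric]
  using code_eq_iff[OF assms] by metis

lemma principal_constacyclic_code_iff:
  assumes "C \<subseteq> carrier_vec n" "n > 0"
  shows "principal_constacyclic_code \<sigma> n C \<longleftrightarrow> constacyclic_polys n (code_polys n C)"
  unfolding principal_constacyclic_code_def principal_constacyclic_code_gen_def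
    constacyclic_polys_def right_divides_iff[symmetric]
  using code_eq_iff[OF assms(1)] binomial_monic[OF assms(2)] by metis

end

theorem mainTheorem3:
  fixes \<sigma> :: "'a::{finite, comm_ring_1} \<Rightarrow> 'a"
    and g :: "'a poly" and n k :: nat and C :: "'a vec set"
  assumes "comm_ring_isom \<sigma>"
    and "n > 0" and "k \<le> n"
    and "lead_coeff g = 1" and "degree g = n - k" and "coeff g 0 dvd 1"
    and "principal_code_gen \<sigma> n g C"
  shows "(principal_code \<sigma> n (dual_code n C) \<longleftrightarrow>
            principal_constacyclic_code \<sigma> n (dual_code n C)) \<and>
         (principal_constacyclic_code \<sigma> n (dual_code n C) \<longleftrightarrow>
            principal_constacyclic_code \<sigma> n C)"
proof -
  interpret skew_polynomials \<sigma> using assms(1) by (simp add: skew_polynomials_def)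
  obtain f where f: "linear_code n C" "degree f = n" "right_divides \<sigma> g f" "C = principal_f_code \<sigma> f g"
    using assms(7) unfolding principal_code_gen_def by blast
  then have C: "C \<subseteq> carrier_vec n" by (simp add: linear_code_def)
  have D: "dual_code n C \<subseteq> carrier_vec n" by (auto simp: dual_code_def)
  have S: "code_polys n C = ideal_code n g"
    using code_polys_principal_f_code[OF f(3,2)] f(4) by simp
  show ?thesis
    unfolding principal_code_iff[OF D] principal_constacyclic_code_iff[OF D assms(2)]
      principal_constacyclic_code_iff[OF C assms(2)] code_polys_dual_code[OF C] S
    by (rule equivalence_polys[OF finite_UNIV assms(4,6,2)]) (simp add: assms(5))
qed

end
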